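(* Let $T$ be a task and let all data be fixed in a task-consistent snapshot. Assume TTL completeness and next-hop closure: for every agent $i$, $\mathcal V_i^H=\{j\in V_{\rm svc}:h(i,j)\le H_{\rm ctrl}\}$ with $h_i(j)=h(i,j)$ for all $j\in\mathcal V_i^H$, and whenever $j\in\mathcal V_i^H$, $j\neq i$ and $k=next_i(j)$, one has $j\in\mathcal V_k^H$ and $h_k(j)=h_i(j)-1$. Assume moreover that the source has a positive attractor: $\mathcal E_{s_T}^{H,+}(T)\neq\emptyset$. Then SPFR started at $s_T$ is loop-free (no agent is visited twice) and terminates at an eligible executor (an agent $m\in\mathcal A_T^0$ that selects itself) after at most $|V|-1$ nonterminal forwarding steps.
   Context: Snapshot. All data below come from one consistent control-plane snapshot and stay fixed while task $T$ is processed. $G=(V,E)$ is the finite undirected graph of agents in the snapshot; $h(i,j)$ is the shortest-hop distance in $G$ ($\infty$ if disconnected). $V_{\rm svc}\subseteq V$ is the set of service-capable agents. Utility and eligibility. Each $j\in V_{\rm svc}$ has $p_j$ capabilities, a state (active/inactive), trust $\tau_j\in[0,1]$, queue $Q_j\ge0$, service rate $\mu_j>0$, unit price $\pi^{\rm unit}_j\ge0$. Task $T$ has source $s_T\in V$, $m_T\ge1$ requirements, workload $\ell_T\ge0$, threshold $\theta_T$, minimum trust $\tau_T^{\min}$, budget $B_T$, deadline $D_T^{\max}$. $M_{ab}(j,T)\in[0,1]$ is the similarity of capability $a$ of $j$ with requirement $b$. $\mathcal X_j(T)$ is the set of binary matrices $[x_{ab}]$ with $\sum_a x_{ab}=1$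 for each $b$, $\sum_b x_{ab}\le1$ for each $a$, and $x_{ab}=0$ if $M_{ab}(j,T)<\theta_T$. If $\mathcal X_j(T)=\emptyset$ then $\chi_j^{\rm cap}(T)=S(j,T)=0$; else $\chi_j^{\rm cap}(T)=1$ and $S(j,T)=m_T^{-1}\max_{\mathbf x\in\mathcal X_j(T)}\sum_{a,b}x_{ab}M_{ab}(j,T)$. With constants $\Delta_{\rm ref},\Pi_{\rm ref}>0$ and weights $w_s,w_l,w_p\ge0$ summing to 1: $D_j^{\rm exec}(T)=(Q_j+\ell_T)/\mu_j$, $\rho_j^T=\min\{(Q_j+\ell_T)/(\mu_j\Delta_{\rm ref}),1\}$, $\pi_j(T)=\pi_j^{\rm unit}\ell_T$, $\widetilde\pi_j(T)=\min\{\pi_j(T)/\Pi_{\rm ref},1\}$, and $U_T(j)=w_sS(j,T)+w_l(1-\rho_j^T)+w_p(1-\widetilde\pi_j(T))\in[0,1]$. Given return-route data $valid_j^{\rm ret}(s_T)\in\{0,1\}$, $K_j^{\rm ret}(s_T)\ge0$, $D_j^{\rm ret}(s_T)\ge0$, the eligible set $\mathcal A_T^0\subseteq V_{\rm svc}$ consists of the active $j\in V_{\rm svc}$ with $\chi_j^{\rm cap}(T)=1$, $\rho_j^T<1$, $\tau_j\ge\tau_T^{\min}$, $valid_j^{\rm ret}(s_T)=1$, $\pi_j(T)+K_j^{\rm ret}(s_T)\le B_T$, $D_j^{\rm exec}(T)+D_j^{\rm ret}(s_T)\le D_T^{\max}$. The gated utility is $\overline U_T(j)=U_T(j)$ if $j\in\mathcal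 A_T^0$ and $0$ otherwise. Local tables. $H_{\rm ctrl}\in\mathbb Z_{\ge0}$ is the control horizon. Each agent $i$ has a set $\mathcal V_i^H\subseteq V_{\rm svc}$ of visible service agents, and for each $j\in\mathcal V_i^H$ a stored hop distance $h_i(j)$ and a next hop $next_i(j)$. If $i\in V_{\rm svc}$ then $i\in\mathcal V_i^H$, $h_i(i)=0$ and $next_i(i)=i$; for $j\ne i$, $next_i(j)$ is a neighbor of $i$ in $G$ lying on a shortest-hop path from $i$ to $j$. Potentials. Fix $\omega_h>0$. For $j\in\mathcal V_i^H$, $\phi_i(j,T)=\overline U_T(j)\exp[-\omega_h h_i(j)]$. Let $\mathcal E_i^H(T)=\mathcal A_T^0\cap\mathcal V_i^H$ and $\mathcal E_i^{H,+}(T)=\{j\in\mathcal E_i^H(T):\overline U_T(j)>0\}$. SPFR (frozen rule). Start at $i=s_T$. At the current agent $i$: if $\mathcal E_i^{H,+}(T)=\emptyset$, stop and return "no route". Otherwise let $j_i^{\rm dom}$ be a maximizer of $\phi_i(\cdot,T)$ over $\mathcal E_i^{H,+}(T)$, ties broken deterministically by a fixed total order on agent identifiers. If $j_i^{\rm dom}=i$, terminate with $i$ as executor. Otherwise, if $|V|-1$ forwarding steps have already been made, return "no route"; else make a nonterminal forwarding step to $next_i(j_i^{\rm dom})$ (forwarding over a link of $G$ succeeds in the frozen analysis) and repeat. *)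

theory Defs
  imports
    Complex_Main
    "HOL-Library.Extended_Nat"
    "Graph_Theory.Arc_Walk"
    "Graph_Theory.Pair_Digraph"
begin

section \<open>Hop distance\<close>

text \<open>The infimum of the empty set of walks is \<open>\<infinity>\<close>, as required for disconnected agents.\<close>

definition hop_dist :: "'v pair_pre_digraph \<Rightarrow> 'v \<Rightarrow> 'v \<Rightarrow> enat" where
  "hop_dist G u v = (INF p \<in> {p. pre_digraph.awalk (with_proj G) u p v}. enat (length p))"

definition shortest_hop_path :: "'v pair_pre_digraph \<Rightarrow> 'v \<Rightarrow> ('v \<times> 'v) list \<Rightarrow> 'v \<Rightarrow> bool" where
  "shortest_hop_path G u p v \<longleftrightarrow>
     pre_digraph.apath (with_proj G) u p v \<and> enat (length p) = hop_dist G u v"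

section \<open>Snapshot and task data\<close>

text \<open>
  Agents are identified with their identifiers; the linear order of the type \<open>'v\<close> is the total
  order used for breaking ties.  The tables \<open>stored_hop S i j\<close> and \<open>next_hop S i j\<close> are
  meaningful only for \<open>j \<in> visible S i\<close>, and agent data only for service-capable agents.
  The arguments of \<open>ret_valid\<close>, \<open>ret_cost\<close>, \<open>ret_delay\<close> are the executor \<open>j\<close> and the
  source to return to.
\<close>

record 'v snapshot =
  net :: "'v pair_pre_digraph"
  svc :: "'v set"
  num_caps :: "'v \<Rightarrow> nat"
  active :: "'v \<Rightarrow> bool"
  trust :: "'v \<Rightarrow> real"
  queue :: "'v \<Rightarrow> real"
  service_rate :: "'v \<Rightarrow> real"
  unit_price :: "'v \<Rightarrow> real"
  ret_valid :: "'v \<Rightarrow> 'v \<Rightarrow> bool"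
  ret_cost :: "'v \<Rightarrow> 'v \<Rightarrow> real"
  ret_delay :: "'v \<Rightarrow> 'v \<Rightarrow> real"
  delay_ref :: real
  price_ref :: real
  w_sim :: real
  w_load :: real
  w_price :: real
  omega_h :: real
  H_ctrl :: nat
  visible :: "'v \<Rightarrow> 'v set"
  stored_hop :: "'v \<Rightarrow> 'v \<Rightarrow> nat"
  next_hop :: "'v \<Rightarrow> 'v \<Rightarrow> 'v"

text \<open>
  \<open>similarity T j a b\<close> is \<open>M\<^sub>a\<^sub>b(j,T)\<close>; capabilities \<open>a\<close> of \<open>j\<close> are numbered from \<open>0\<close> to
  \<open>num_caps S j - 1\<close>, requirements \<open>b\<close> of \<open>T\<close> from \<open>0\<close> to \<open>num_reqs T - 1\<close>.
\<close>

record 'v task =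
  source :: 'v
  num_reqs :: nat
  workload :: real
  sim_threshold :: real
  min_trust :: real
  budget :: real
  deadline :: real
  similarity :: "'v \<Rightarrow> nat \<Rightarrow> nat \<Rightarrow> real"

abbreviation agents :: "'v snapshot \<Rightarrow> 'v set" where
  "agents S \<equiv> pverts (net S)"

definition valid_tables :: "'v snapshot \<Rightarrow> bool" where
  "valid_tables S \<longleftrightarrow>
     (\<forall>i \<in> agents S.
        visible S i \<subseteq> svc S \<and>
        (i \<in> svc S \<longrightarrow> i \<in> visible S i \<and> stored_hop S i i = 0 \<and> next_hop S i i = i) \<and>
        (\<forall>j \<in> visible S i. j \<noteq> i \<longrightarrow>
           (i, next_hop S i j) \<in> parcs (net S) \<and>
           (\<exists>p. shortest_hop_path (net S) i p j \<and>
                next_hop S i j \<in> set (pre_digraph.awalk_verts (with_proj (net S)) i p))))"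

definition valid_snapshot :: "'v snapshot \<Rightarrow> bool" where
  "valid_snapshot S \<longleftrightarrow>
     pair_graph (net S) \<and>
     svc S \<subseteq> agents S \<and>
     (\<forall>j \<in> svc S. 0 \<le> trust S j \<and> trust S j \<le> 1 \<and> 0 \<le> queue S j \<and>
        0 < service_rate S j \<and> 0 \<le> unit_price S j) \<and>
     (\<forall>j \<in> svc S. \<forall>s \<in> agents S. 0 \<le> ret_cost S j s \<and> 0 \<le> ret_delay S j s) \<and>
     0 < delay_ref S \<and> 0 < price_ref S \<and>
     0 \<le> w_sim S \<and> 0 \<le> w_load S \<and> 0 \<le> w_price S \<and> w_sim S + w_load S + w_price S = 1 \<and>
     0 < omega_h S \<and>
     valid_tables S"

definition valid_task :: "'v snapshot \<Rightarrow> 'v task \<Rightarrow> bool" where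
  "valid_task S T \<longleftrightarrow>
     source T \<in> agents S \<and> 1 \<le> num_reqs T \<and> 0 \<le> workload T \<and>
     (\<forall>j \<in> svc S. \<forall>a < num_caps S j. \<forall>b < num_reqs T.
        0 \<le> similarity T j a b \<and> similarity T j a b \<le> 1)"

section \<open>Utility and eligibility\<close>

text \<open>A matrix is a function of row and column index that vanishes outside its index range.\<close>

definition assignments :: "'v snapshot \<Rightarrow> 'v task \<Rightarrow> 'v \<Rightarrow> (nat \<Rightarrow> nat \<Rightarrow> nat) set" where
  "assignments S T j =
     {x. (\<forall>a b. x a b \<in> {0, 1}) \<and>
         (\<forall>a b. \<not> (a < num_caps S j \<and> b < num_reqs T) \<longrightarrow> x a b = 0) \<and>
         (\<forall>b < num_reqs T. (\<Sum>a < num_caps S j. x a b) = 1) \<and>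
         (\<forall>a < num_caps S j. (\<Sum>b < num_reqs T. x a b) \<le> 1) \<and>
         (\<forall>a < num_caps S j. \<forall>b < num_reqs T.
            similarity T j a b < sim_threshold T \<longrightarrow> x a b = 0)}"

definition chi_cap :: "'v snapshot \<Rightarrow> 'v task \<Rightarrow> 'v \<Rightarrow> nat" where
  "chi_cap S T j = (if assignments S T j = {} then 0 else 1)"

definition match_score :: "'v snapshot \<Rightarrow> 'v task \<Rightarrow> 'v \<Rightarrow> real" where
  "match_score S T j =
     (if assignments S T j = {} then 0
      else Max ((\<lambda>x. \<Sum>a < num_caps S j. \<Sum>b < num_reqs T. real (x a b) * similarity T j a b)
                  ` assignments S T j) / real (num_reqs T))"

definition exec_delay :: "'v snapshot \<Rightarrow> 'v task \<Rightarrow> 'v \<Rightarrow> real" where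
  "exec_delay S T j = (queue S j + workload T) / service_rate S j"

definition load :: "'v snapshot \<Rightarrow> 'v task \<Rightarrow> 'v \<Rightarrow> real" where
  "load S T j = min ((queue S j + workload T) / (service_rate S j * delay_ref S)) 1"

definition price :: "'v snapshot \<Rightarrow> 'v task \<Rightarrow> 'v \<Rightarrow> real" where
  "price S T j = unit_price S j * workload T"

definition norm_price :: "'v snapshot \<Rightarrow> 'v task \<Rightarrow> 'v \<Rightarrow> real" where
  "norm_price S T j = min (price S T j / price_ref S) 1"

definition utility :: "'v snapshot \<Rightarrow> 'v task \<Rightarrow> 'v \<Rightarrow> real" where
  "utility S T j =
     w_sim S * match_score S T j + w_load S * (1 - load S T j) + w_price S * (1 - norm_price S T j)"

definition eligible :: "'v snapshot \<Rightarrow> 'v task \<Rightarrow> 'v set" where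
  "eligible S T =
     {j \<in> svc S. active S j \<and> chi_cap S T j = 1 \<and> load S T j < 1 \<and>
        trust S j \<ge> min_trust T \<and> ret_valid S j (source T) \<and>
        price S T j + ret_cost S j (source T) \<le> budget T \<and>
        exec_delay S T j + ret_delay S j (source T) \<le> deadline T}"

definition gated_utility :: "'v snapshot \<Rightarrow> 'v task \<Rightarrow> 'v \<Rightarrow> real" where
  "gated_utility S T j = (if j \<in> eligible S T then utility S T j else 0)"

section \<open>Potentials and the forwarding rule\<close>

definition potential :: "'v snapshot \<Rightarrow> 'v task \<Rightarrow> 'v \<Rightarrow> 'v \<Rightarrow> real" where
  "potential S T i j = gated_utility S T j * exp (- omega_h S * real (stored_hop S i j))"

definition local_eligible :: "'v snapshot \<Rightarrow> 'v task \<Rightarrow> 'v \<Rightarrow> 'v set" where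
  "local_eligible S T i = eligible S T \<inter> visible S i"

definition attractors :: "'v snapshot \<Rightarrow> 'v task \<Rightarrow> 'v \<Rightarrow> 'v set" where
  "attractors S T i = {j \<in> local_eligible S T i. gated_utility S T j > 0}"

text \<open>Meaningful only if \<open>attractors S T i\<close> is nonempty.\<close>

definition dominant :: "'v::linorder snapshot \<Rightarrow> 'v task \<Rightarrow> 'v \<Rightarrow> 'v" where
  "dominant S T i = Min {j. is_arg_max (potential S T i) (\<lambda>j. j \<in> attractors S T i) j}"

datatype 'v outcome = No_Route | Executor 'v

text \<open>
  \<open>spfr_from S T i n\<close> is the run of the rule from current agent \<open>i\<close> after \<open>n\<close> forwarding steps:
  the list of agents visited from then on (starting with \<open>i\<close>), and the outcome.  Each
  nonterminal forwarding step contributes one further agent to the list.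
\<close>

function spfr_from ::
  "'v::linorder snapshot \<Rightarrow> 'v task \<Rightarrow> 'v \<Rightarrow> nat \<Rightarrow> 'v list \<times> 'v outcome" where
  "spfr_from S T i n =
     (if attractors S T i = {} then ([i], No_Route)
      else if dominant S T i = i then ([i], Executor i)
      else if n \<ge> card (agents S) - 1 then ([i], No_Route)
      else (let (vs, r) = spfr_from S T (next_hop S i (dominant S T i)) (Suc n) in (i # vs, r)))"
  by pat_completeness auto
termination
  by (relation "measure (\<lambda>(S, T, i, n). card (agents S) - 1 - n)") auto

declare spfr_from.simps [simp del]

definition spfr :: "'v::linorder snapshot \<Rightarrow> 'v task \<Rightarrow> 'v list \<times> 'v outcome" where
  "spfr S T = spfr_from S T (source T) 0"

section \<open>Table assumptions\<close>

definition ttl_complete :: "'v snapshot \<Rightarrow> bool" where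
  "ttl_complete S \<longleftrightarrow>
     (\<forall>i \<in> agents S.
        visible S i = {j \<in> svc S. hop_dist (net S) i j \<le> enat (H_ctrl S)} \<and>
        (\<forall>j \<in> visible S i. enat (stored_hop S i j) = hop_dist (net S) i j))"

definition next_hop_closed :: "'v snapshot \<Rightarrow> bool" where
  "next_hop_closed S \<longleftrightarrow>
     (\<forall>i \<in> agents S. \<forall>j \<in> visible S i. j \<noteq> i \<longrightarrow>
        (let k = next_hop S i j in
           j \<in> visible S k \<and> int (stored_hop S k j) = int (stored_hop S i j) - 1))"

end

theory Submission
  imports Defs
begin

text \<open>
  Forwarding towards the dominant agent \<open>d\<close> of \<open>i\<close> brings \<open>d\<close> exactly one hop closer, so its
  potential is multiplied by \<open>exp \<omega>\<^sub>h > 1\<close>.  Hence the maximal potential over the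
  attractors strictly increases along a run: no agent is visited twice, and since the number of
  agents of at least the current maximal potential drops with every step, the hop budget is never
  exhausted.
\<close>

text \<open>The quantity that strictly increases along a run. Where \<open>attractors S T i\<close>
  is empty, \<open>dominant S T i\<close> is \<open>Min {}\<close>, so the value is some unspecified
  real.\<close>

definition peak_potential :: "'v::linorder snapshot \<Rightarrow> 'v task \<Rightarrow> 'v \<Rightarrow> real" where
  "peak_potential S T i = potential S T i (dominant S T i)"

text \<open>\<open>Min\<close> is a member of the set of maximizers only if that set is finite and
  nonempty; a finite nonempty attractor set gives both, since its maximal potential is
  attained.\<close>

lemma dominant_is_arg_max:
  fixes S :: "'v::linorder snapshot"
  assumes "finite (attractors S T i)" and "attractors S T i \<noteq> {}"
  shows "is_arg_max (potential S T i) (\<lambda>j. j \<in> attractors S T i) (dominant S T i)"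
proof -
  let ?M = "{j. is_arg_max (potential S T i) (\<lambda>j. j \<in> attractors S T i) j}"
  have "finite ?M"
    by (rule finite_subset[OF _ assms(1)]) (auto simp: is_arg_max_def)
  moreover have "?M \<noteq> {}"
  proof -
    have "Max (potential S T i ` attractors S T i) \<in> potential S T i ` attractors S T i"
      using assms by (intro Max_in) auto
    then obtain j where j: "j \<in> attractors S T i"
      "Max (potential S T i ` attractors S T i) = potential S T i j"
      by blast
    then have "potential S T i l \<le> potential S T i j" if "l \<in> attractors S T i" for l
      using that assms(1) by (metis Max_ge finite_imageI imageI)
    with j(1) have "j \<in> ?M" by (auto simp: is_arg_max_def not_less)
    then show ?thesis by blast
  qed
  ultimately have "Min ?M \<in> ?M" by (rule Min_in)
  then show ?thesis by (simp add: dominant_def)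
qed

lemma dominant_in_attractors:
  fixes S :: "'v::linorder snapshot"
  assumes "finite (attractors S T i)" and "attractors S T i \<noteq> {}"
  shows "dominant S T i \<in> attractors S T i"
  using dominant_is_arg_max[OF assms] by (simp add: is_arg_max_def)

lemma potential_le_peak:
  fixes S :: "'v::linorder snapshot"
  assumes "finite (attractors S T i)" and "j \<in> attractors S T i"
  shows "potential S T i j \<le> peak_potential S T i"
proof -
  have "attractors S T i \<noteq> {}" using assms(2) by blast
  from dominant_is_arg_max[OF assms(1) this] show ?thesis
    using assms(2) by (auto simp: is_arg_max_def peak_potential_def not_less)
qed

lemma pair_graph_net: "valid_snapshot S \<Longrightarrow> pair_graph (net S)"
  by (simp add: valid_snapshot_def)

lemma finite_agents:
  assumes "valid_snapshot S"
  shows "finite (agents S)"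
proof -
  interpret pair_graph "net S" by (rule pair_graph_net[OF assms])
  show ?thesis by (rule pair_finite_verts)
qed

lemma finite_attractors:
  assumes "valid_snapshot S"
  shows "finite (attractors S T i)"
proof (rule finite_subset)
  show "attractors S T i \<subseteq> agents S"
    using assms
    by (auto simp: valid_snapshot_def attractors_def local_eligible_def eligible_def)
qed (rule finite_agents[OF assms])

lemma next_hop_in_agents:
  assumes "valid_snapshot S" and "i \<in> agents S" and "j \<in> visible S i" and "j \<noteq> i"
  shows "next_hop S i j \<in> agents S"
proof -
  interpret pair_graph "net S" by (rule pair_graph_net[OF assms(1)])
  have "(i, next_hop S i j) \<in> parcs (net S)"
    using assms by (auto simp: valid_snapshot_def valid_tables_def)
  then show ?thesis by (rule in_arcsD2)
qed

lemma forwarding_step: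
  fixes S :: "'v::linorder snapshot"
  assumes S: "valid_snapshot S" and closed: "next_hop_closed S"
    and i: "i \<in> agents S" "attractors S T i \<noteq> {}" "dominant S T i \<noteq> i"
  defines "k \<equiv> next_hop S i (dominant S T i)"
  shows "k \<in> agents S" and "attractors S T k \<noteq> {}"
    and "peak_potential S T i < peak_potential S T k"
proof -
  let ?d = "dominant S T i"
  have d: "?d \<in> attractors S T i"
    using dominant_in_attractors[OF finite_attractors[OF S] i(2)] .
  then have vis: "?d \<in> visible S i" and util: "gated_utility S T ?d > 0"
    by (auto simp: attractors_def local_eligible_def)
  show "k \<in> agents S"
    unfolding k_def using next_hop_in_agents[OF S i(1) vis i(3)] .
  have visk: "?d \<in> visible S k" and hop: "int (stored_hop S k ?d) = int (stored_hop S i ?d) - 1"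
    using closed i vis by (auto simp: next_hop_closed_def k_def Let_def)
  \<comment> \<open>Eligibility and gated utility do not depend on the current agent, so visibility
    from \<open>k\<close> is all that has to be rechecked.\<close>
  have dk: "?d \<in> attractors S T k"
    using d visk by (auto simp: attractors_def local_eligible_def)
  then show "attractors S T k \<noteq> {}" by blast
  \<comment> \<open>The closure equation is over the integers, so no truncated subtraction can hide
    a stored distance of 0 at \<open>i\<close>.\<close>
  have "stored_hop S k ?d < stored_hop S i ?d" using hop by linarith
  moreover have "omega_h S > 0" using S by (simp add: valid_snapshot_def)
  ultimately have "peak_potential S T i < potential S T k ?d"
    using util by (simp add: peak_potential_def potential_def)
  also have "\<dots> \<le> peak_potential S T k"
    by (rule potential_le_peak[OF finite_attractors[OF S] dk])
  finally show "peak_potential S T i < peak_potential S T k" .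
qed

text \<open>The last assumption is the budget invariant: a step adds one to \<open>n\<close> and
  removes at least one agent from the counted set. Agents without attractors may be counted through
  their unspecified peak, which is harmless because only the inclusion in \<open>agents S\<close>
  bounds the count.\<close>

lemma spfr_from_reaches_executor:
  fixes S :: "'v::linorder snapshot"
  assumes S: "valid_snapshot S" and closed: "next_hop_closed S"
    and "i \<in> agents S" and "attractors S T i \<noteq> {}"
    and "n + card {v \<in> agents S. peak_potential S T i \<le> peak_potential S T v} \<le> card (agents S)"
  shows "\<exists>vs m. spfr_from S T i n = (i # vs, Executor m) \<and> last (i # vs) = m \<and>
           sorted_wrt (\<lambda>u v. peak_potential S T u < peak_potential S T v) (i # vs) \<and>
           set (i # vs) \<subseteq> agents S \<and> attractors S T m \<noteq> {} \<and> dominant S T m = m"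
  using assms(3-)
proof (induction "card {v \<in> agents S. peak_potential S T i \<le> peak_potential S T v}"
    arbitrary: i n rule: less_induct)
  case (less i n)
  let ?above = "\<lambda>i. {v \<in> agents S. peak_potential S T i \<le> peak_potential S T v}"
  show ?case
  proof (cases "dominant S T i = i")
    case True
    then show ?thesis using less.prems by (simp add: spfr_from.simps[of S T i n])
  next
    case False
    define k where "k = next_hop S i (dominant S T i)"
    note step = forwarding_step[OF S closed less.prems(1,2) False, folded k_def]
    \<comment> \<open>Inclusion is transitivity; it is proper because \<open>i\<close> itself drops
      out.\<close>
    have "?above k \<subset> ?above i" using step less.prems(1) by force
    then have drop: "card (?above k) < card (?above i)"
      by (intro psubset_card_mono) (simp_all add: finite_agents[OF S])
    \<comment> \<open>\<open>k\<close> counts itself, so at least two agents are counted at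
      \<open>i\<close>. The invariant then gives \<open>n\<close> at most
      \<open>card (agents S) - 2\<close>, and the budget test fails.\<close>
    have "card (?above k) > 0"
      using step(1) by (auto simp: card_gt_0_iff finite_agents[OF S])
    then have n: "\<not> n \<ge> card (agents S) - 1" using drop less.prems(3) by linarith
    have "Suc n + card (?above k) \<le> card (agents S)" using drop less.prems(3) by linarith
    from less.hyps[OF drop step(1,2) this] obtain vs m where
      run: "spfr_from S T k (Suc n) = (k # vs, Executor m)" "last (k # vs) = m"
        "sorted_wrt (\<lambda>u v. peak_potential S T u < peak_potential S T v) (k # vs)"
        "set (k # vs) \<subseteq> agents S" "attractors S T m \<noteq> {}" "dominant S T m = m"
      by blast
    have "spfr_from S T i n = (i # k # vs, Executor m)"
      using less.prems(2) False n run(1)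
      by (simp add: spfr_from.simps[of S T i n] k_def[symmetric])
    moreover have
      "sorted_wrt (\<lambda>u v. peak_potential S T u < peak_potential S T v) (i # k # vs)"
      using run(3) step(3) by auto
    ultimately show ?thesis using run less.prems(1) by auto
  qed
qed

theorem theorem3:
  fixes S :: "'v::linorder snapshot" and T :: "'v task"
  assumes "valid_snapshot S"
    and "valid_task S T"
    and "ttl_complete S"
    and "next_hop_closed S"
    and "attractors S T (source T) \<noteq> {}"
  shows "\<exists>vs m. spfr S T = (vs, Executor m) \<and>
           hd vs = source T \<and> last vs = m \<and>
           distinct vs \<and>
           m \<in> eligible S T \<and> m \<in> attractors S T m \<and> dominant S T m = m \<and>
           length vs - 1 \<le> card (agents S) - 1"
proof -
  have "source T \<in> agents S" using assms(2) by (simp add: valid_task_def)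
  \<comment> \<open>With no steps made, the invariant only says that a set of agents has at most
    \<open>card (agents S)\<close> elements.\<close>
  moreover have
    "0 + card {v \<in> agents S. peak_potential S T (source T) \<le> peak_potential S T v}
       \<le> card (agents S)"
    by (simp add: card_mono finite_agents[OF assms(1)])
  ultimately obtain vs m where
    run: "spfr S T = (source T # vs, Executor m)" "last (source T # vs) = m"
      "sorted_wrt (\<lambda>u v. peak_potential S T u < peak_potential S T v) (source T # vs)"
      "set (source T # vs) \<subseteq> agents S" "attractors S T m \<noteq> {}" "dominant S T m = m"
    unfolding spfr_def
    using spfr_from_reaches_executor[OF assms(1,4) _ assms(5)] by blast
  \<comment> \<open>A revisited agent would repeat its peak in a strictly increasing list.\<close>
  have "sorted_wrt (<) (map (peak_potential S T) (source T # vs))"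
    using run(3) by (simp only: sorted_wrt_map)
  then have dist: "distinct (source T # vs)"
    unfolding strict_sorted_iff distinct_map by blast
  have len: "length (source T # vs) \<le> card (agents S)"
    using card_mono[OF finite_agents[OF assms(1)] run(4)] distinct_card[OF dist] by simp
  \<comment> \<open>Nonempty attractors at \<open>m\<close> ensure that
    \<open>dominant S T m = m\<close> names a genuine maximizer, hence an eligible agent.\<close>
  have m: "m \<in> attractors S T m"
    using dominant_in_attractors[OF finite_attractors[OF assms(1)] run(5)] run(6) by simp
  then have "m \<in> eligible S T" by (simp add: attractors_def local_eligible_def)
  with m show ?thesis
    using run(1,2,6) dist len by (intro exI[of _ "source T # vs"] exI[of _ m]) auto
qed

end
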